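(* Let $X_e=(X_1,X_2,X_3)$ be a configuration of three point vortices on the hyperbolic plane, with nonzero real vorticities $\Gamma_1,\Gamma_2,\Gamma_3$. If $X_e$ is a relative equilibrium of the point vortex system, then either $X_e$ is an equilateral triangle (the three mutual hyperbolic distances are equal) or $X_e$ is a geodesic configuration (the three points lie on a common geodesic).
   Context: On $\mathbb{R}^3$ let $\langle X_1,X_2\rangle_{\mathcal H}=x_1x_2+y_1y_2-z_1z_2$ and $X_1\times_{\mathcal H}X_2=(y_1z_2-z_1y_2,\ z_1x_2-x_1z_2,\ -x_1y_2+y_1x_2)$. The hyperbolic plane is $\mathcal H_2=\{(x,y,z)\in\mathbb{R}^3\mid z^2-x^2-y^2=1,\ z>0\}$ with the metric $dx^2+dy^2-dz^2$; hyperbolic distance satisfies $\langle X_1,X_2\rangle_{\mathcal H}=-\cosh d(X_1,X_2)$, and geodesics are the intersections of $\mathcal H_2$ with planes through the origin. The phase space for $N$ vortices is $\mathcal M=\mathcal H_2^N\setminus\Delta$, where $\Delta$ is the set of configurations in which two or more points coincide. The dynamics is $$\dot X_r=\frac1\pi\sum_{p\ne r}\Gamma_p\frac{X_p\times_{\mathcal H}X_r}{\langle X_r,X_p\rangle_{\mathcal H}^2-1},\qquad r=1,\dots,N.$$ The group $SL(2,\mathbb{R})$ acts on $\mathbb{R}^3$ by conjugation $\rho\mapsto g\rho g^{-1}$ under the identification $(x,y,z)\leftrightarrow\begin{pmatrix} x & y+z \\ y-z & -x \end{pmatrix}$; this preserves $\mathcal H_2$ and acts diagonally on $\mathcal M$.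 A point $X_e\in\mathcal M$ is a relative equilibrium if the trajectory through $X_e$ is contained in the $SL(2,\mathbb{R})$-orbit of $X_e$. *)

theory Defs
  imports "HOL-Analysis.Analysis"
begin

text \<open>Points are vectors \<open>(x, y, z)\<close> with \<open>x = v $ 1\<close>, \<open>y = v $ 2\<close>, \<open>z = v $ 3\<close>.\<close>

definition hinner :: "real^3 \<Rightarrow> real^3 \<Rightarrow> real" where
  "hinner X Y = X$1 * Y$1 + X$2 * Y$2 - X$3 * Y$3"

definition hcross :: "real^3 \<Rightarrow> real^3 \<Rightarrow> real^3" where
  "hcross X Y = vector [X$2 * Y$3 - X$3 * Y$2, X$3 * Y$1 - X$1 * Y$3, - (X$1 * Y$2) + X$2 * Y$1]"

definition hyp_plane :: "(real^3) set" where
  "hyp_plane = {v. (v$3)\<^sup>2 - (v$1)\<^sup>2 - (v$2)\<^sup>2 = 1 \<and> v$3 > 0}"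

text \<open>The argument of \<open>arcosh\<close> is at least 1 for points of the hyperbolic plane, so that
  \<open>hdist\<close> is the nonnegative solution \<open>d\<close> of \<open>hinner X Y = - cosh d\<close>; see \<open>hinner_eq_cosh\<close>.\<close>

definition hdist :: "real^3 \<Rightarrow> real^3 \<Rightarrow> real" where
  "hdist X Y = arcosh (- hinner X Y)"

lemma hinner_le_minus_one:
  assumes "X \<in> hyp_plane" "Y \<in> hyp_plane"
  shows "hinner X Y \<le> - 1"
proof -
  define x1 y1 z1 x2 y2 z2 where d: "x1 = X$1" "y1 = X$2" "z1 = X$3" "x2 = Y$1" "y2 = Y$2" "z2 = Y$3"
  have z: "z1\<^sup>2 = 1 + x1\<^sup>2 + y1\<^sup>2" "z2\<^sup>2 = 1 + x2\<^sup>2 + y2\<^sup>2" "z1 > 0" "z2 > 0"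
    using assms by (auto simp: hyp_plane_def d)
  have "(z1 * z2)\<^sup>2 - (1 + x1*x2 + y1*y2)\<^sup>2 = (x1 - x2)\<^sup>2 + (y1 - y2)\<^sup>2 + (x1*y2 - x2*y1)\<^sup>2"
    unfolding power_mult_distrib z by (simp add: power2_eq_square algebra_simps)
  then have "(1 + x1*x2 + y1*y2)\<^sup>2 \<le> (z1 * z2)\<^sup>2"
    by (smt (verit) zero_le_power2)
  then have "1 + x1*x2 + y1*y2 \<le> z1 * z2"
    by (rule power2_le_imp_le) (use z(3,4) in simp)
  then show ?thesis
    by (simp add: hinner_def d)
qed

lemma hinner_eq_cosh:
  assumes "X \<in> hyp_plane" "Y \<in> hyp_plane"
  shows "hinner X Y = - cosh (hdist X Y)" "hdist X Y \<ge> 0"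
  using hinner_le_minus_one[OF assms] by (auto simp: hdist_def)

definition geodesics :: "(real^3) set set" where
  "geodesics = {hyp_plane \<inter> P | P. subspace P \<and> dim P = 2 \<and> hyp_plane \<inter> P \<noteq> {}}"


text \<open>A configuration of \<open>N = CARD('n)\<close> vortices is an element \<open>X\<close> of \<open>real^3^'n\<close>, with \<open>X $ r\<close>
  the position of vortex \<open>r\<close>.\<close>

definition phase_space :: "(real^3^'n) set" where
  "phase_space = {X. (\<forall>r. X$r \<in> hyp_plane) \<and> (\<forall>r p. r \<noteq> p \<longrightarrow> X$r \<noteq> X$p)}"

definition vortex_field :: "real^'n \<Rightarrow> real^3^'n \<Rightarrow> real^3^'n" where
  "vortex_field \<Gamma> X = (\<chi> r. (1 / pi) *\<^sub>R
     (\<Sum>p\<in>UNIV - {r}. (\<Gamma>$p / ((hinner (X$r) (X$p))\<^sup>2 - 1)) *\<^sub>R hcross (X$p) (X$r)))"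

definition integral_curve :: "real^'n \<Rightarrow> real^3^'n \<Rightarrow> real set \<Rightarrow> (real \<Rightarrow> real^3^'n) \<Rightarrow> bool" where
  "integral_curve \<Gamma> X0 J u \<longleftrightarrow>
     open J \<and> is_interval J \<and> 0 \<in> J \<and> u 0 = X0 \<and>
     (\<forall>t\<in>J. u t \<in> phase_space \<and> (u has_vector_derivative vortex_field \<Gamma> (u t)) (at t))"

definition maximal_integral_curve :: "real^'n \<Rightarrow> real^3^'n \<Rightarrow> real set \<Rightarrow> (real \<Rightarrow> real^3^'n) \<Rightarrow> bool" where
  "maximal_integral_curve \<Gamma> X0 J u \<longleftrightarrow>
     integral_curve \<Gamma> X0 J u \<and>
     (\<forall>K v. integral_curve \<Gamma> X0 K v \<and> J \<subseteq> K \<and> (\<forall>t\<in>J. v t = u t) \<longrightarrow> K = J)"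


definition SL2 :: "(real^2^2) set" where
  "SL2 = {g. det g = 1}"

definition to_mat :: "real^3 \<Rightarrow> real^2^2" where
  "to_mat v = vector [vector [v$1, v$2 + v$3], vector [v$2 - v$3, - (v$1)]]"

text \<open>On trace-free matrices, \<open>of_mat\<close> is the inverse of \<open>to_mat\<close>.\<close>

definition of_mat :: "real^2^2 \<Rightarrow> real^3" where
  "of_mat A = vector [A$1$1, (A$1$2 + A$2$1) / 2, (A$1$2 - A$2$1) / 2]"

definition sl2_act :: "real^2^2 \<Rightarrow> real^3 \<Rightarrow> real^3" where
  "sl2_act g v = of_mat (g ** to_mat v ** matrix_inv g)"

lemma of_mat_to_mat: "of_mat (to_mat v) = v"
  by (simp add: of_mat_def to_mat_def vec_eq_iff forall_3)

lemma to_mat_of_mat: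
  assumes "trace A = 0"
  shows "to_mat (of_mat A) = A"
  using assms by (simp add: of_mat_def to_mat_def vec_eq_iff forall_2 trace_def sum_2 field_simps)

lemma to_mat_sl2_act:
  assumes "g \<in> SL2"
  shows "to_mat (sl2_act g v) = g ** to_mat v ** matrix_inv g"
proof -
  have "invertible g"
    using assms by (simp add: SL2_def invertible_det_nz)
  then have "matrix_inv g ** g = mat 1"
    unfolding invertible_def matrix_inv_def by (rule someI2_ex) simp
  then have "trace (g ** to_mat v ** matrix_inv g) = trace (to_mat v)"
    by (subst trace_mul_sym) (simp add: matrix_mul_assoc)
  also have "\<dots> = 0"
    by (simp add: trace_def sum_2 to_mat_def)
  finally show ?thesis
    by (simp add: sl2_act_def to_mat_of_mat)
qed

definition orbit :: "real^3^'n \<Rightarrow> (real^3^'n) set" where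
  "orbit X = {(\<chi> r. sl2_act g (X$r)) | g. g \<in> SL2}"

text \<open>The field is smooth on the phase space, so a maximal integral curve through a given
  configuration exists and is unique; its image is the trajectory.\<close>

definition relative_equilibrium :: "real^'n \<Rightarrow> real^3^'n \<Rightarrow> bool" where
  "relative_equilibrium \<Gamma> X \<longleftrightarrow>
     X \<in> phase_space \<and> (\<exists>J u. maximal_integral_curve \<Gamma> X J u \<and> u ` J \<subseteq> orbit X)"


definition equilateral :: "real^3^3 \<Rightarrow> bool" where
  "equilateral X \<longleftrightarrow> hdist (X$1) (X$2) = hdist (X$2) (X$3) \<and> hdist (X$2) (X$3) = hdist (X$3) (X$1)"

definition geodesic_configuration :: "real^3^'n \<Rightarrow> bool" where
  "geodesic_configuration X \<longleftrightarrow> (\<exists>\<gamma>\<in>geodesics. \<forall>r. X$r \<in> \<gamma>)"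

end

theory Submission imports Defs begin

text \<open>Conjugation preserves \<open>hinner\<close>, so along a relative equilibrium all pairwise products are
  constant. The derivative of the product of vortices \<open>i\<close> and \<open>j\<close> at time \<open>0\<close> is, up to the factor
  \<open>1 / pi\<close>, the vorticity of the third vortex \<open>k\<close> times the determinant of the configuration times the
  difference of \<open>1 / (hinner\<^sup>2 - 1)\<close> on the sides \<open>ik\<close> and \<open>jk\<close>. Hence either the determinant
  vanishes, and the points lie in a plane through the origin, or all the sides agree.\<close>

lemma bounded_bilinear_hinner: "bounded_bilinear hinner"
proof -
  have "bilinear hinner"
    by (auto simp: bilinear_def hinner_def algebra_simps intro!: linearI)
  then show ?thesis
    by (simp add: bilinear_conv_bounded_bilinear)
qed

lemma hinner_commute: "hinner v w = hinner w v"
  by (simp add: hinner_def mult.commute)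

text \<open>Up to the factor 1/2 the form is the trace form on trace-free matrices. This turns
  invariance under conjugation into cyclicity of the trace.\<close>

lemma hinner_eq_trace: "hinner v w = trace (to_mat v ** to_mat w) / 2"
  by (simp add: hinner_def to_mat_def trace_def matrix_matrix_mult_def sum_2 field_simps)

lemma hinner_sl2_act:
  assumes "g \<in> SL2"
  shows "hinner (sl2_act g v) (sl2_act g w) = hinner v w"
proof -
  have "invertible g"
    using assms by (simp add: SL2_def invertible_det_nz)
  then have inv: "matrix_inv g ** g = mat 1"
    unfolding invertible_def matrix_inv_def by (rule someI2_ex) simp
  have "trace (to_mat (sl2_act g v) ** to_mat (sl2_act g w))
      = trace (g ** (to_mat v ** (matrix_inv g ** g) ** to_mat w ** matrix_inv g))"
    by (simp add: to_mat_sl2_act[OF assms] matrix_mul_assoc)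
  also have "\<dots> = trace (to_mat v ** to_mat w ** matrix_inv g ** g)"
    by (subst trace_mul_sym) (simp add: inv)
  also have "\<dots> = trace (to_mat v ** to_mat w)"
    by (simp add: inv matrix_mul_assoc[symmetric])
  finally show ?thesis
    by (simp add: hinner_eq_trace)
qed

lemma relative_equilibrium_hinner_stationary:
  assumes "relative_equilibrium \<Gamma> X"
  shows "hinner (X$i) (vortex_field \<Gamma> X $ j) + hinner (vortex_field \<Gamma> X $ i) (X$j) = 0"
proof -
  obtain J u where u: "integral_curve \<Gamma> X J u" and orb: "u ` J \<subseteq> orbit X"
    using assms by (auto simp: relative_equilibrium_def maximal_integral_curve_def)
  then have J: "open J" "0 \<in> J" and u0: "u 0 = X"
    and deriv: "(u has_vector_derivative vortex_field \<Gamma> X) (at 0)"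
    by (auto simp: integral_curve_def)
  have comp: "((\<lambda>t. u t $ k) has_vector_derivative vortex_field \<Gamma> X $ k) (at 0)" for k
    by (rule bounded_linear.has_vector_derivative[OF bounded_linear_vec_nth deriv])
  have "((\<lambda>t. hinner (u t $ i) (u t $ j)) has_vector_derivative
      (hinner (u 0 $ i) (vortex_field \<Gamma> X $ j) + hinner (vortex_field \<Gamma> X $ i) (u 0 $ j))) (at 0)"
    by (rule bounded_bilinear.has_vector_derivative[OF bounded_bilinear_hinner comp comp])
  moreover have const: "hinner (u t $ i) (u t $ j) = hinner (X$i) (X$j)" if "t \<in> J" for t
  proof -
    have "u t \<in> orbit X"
      using orb that by blast
    then obtain g where "g \<in> SL2" "u t = (\<chi> r. sl2_act g (X$r))"
      by (auto simp: orbit_def)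
    then show ?thesis
      by (simp add: hinner_sl2_act)
  qed
  \<comment> \<open>On \<open>J\<close>, an open neighbourhood of 0, the product agrees with a
    constant. Uniqueness of the derivative then forces the product-rule expression to
    vanish.\<close>
  have "((\<lambda>t. hinner (u t $ i) (u t $ j)) has_vector_derivative 0) (at 0)"
    by (rule has_vector_derivative_transform_within_open[OF has_vector_derivative_const J])
       (simp add: const)
  ultimately show ?thesis
    using vector_derivative_unique_at u0 by blast
qed

lemma hinner_eq_if_stationary:
  fixes \<Gamma> :: "real^3" and X :: "real^3^3"
  assumes \<Gamma>: "\<Gamma>$k \<noteq> 0" and D: "hinner (hcross (X$k) (X$i)) (X$j) \<noteq> 0"
    and distinct: "UNIV = {i, j, k}" "i \<noteq> j" "j \<noteq> k" "i \<noteq> k"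
    and hyp: "\<And>r. X$r \<in> hyp_plane"
    and stat: "hinner (X$i) (vortex_field \<Gamma> X $ j) + hinner (vortex_field \<Gamma> X $ i) (X$j) = 0"
  shows "hinner (X$i) (X$k) = hinner (X$j) (X$k)"
proof -
  let ?D = "hinner (hcross (X$k) (X$i)) (X$j)"
  let ?w = "\<lambda>r p. \<Gamma>$p / ((hinner (X$r) (X$p))\<^sup>2 - 1)"
  have rest: "UNIV - {i} = {j, k}" "UNIV - {j} = {i, k}"
    using distinct by auto
  have F: "vortex_field \<Gamma> X $ i
        = (1/pi) *\<^sub>R (?w i j *\<^sub>R hcross (X$j) (X$i) + ?w i k *\<^sub>R hcross (X$k) (X$i))"
      "vortex_field \<Gamma> X $ j
        = (1/pi) *\<^sub>R (?w j i *\<^sub>R hcross (X$i) (X$j) + ?w j k *\<^sub>R hcross (X$k) (X$j))"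
    using distinct by (simp_all add: vortex_field_def rest)
  \<comment> \<open>The sign in the third component of \<open>hcross\<close> cancels the one in
    \<open>hinner\<close>, so the triple product is the ordinary determinant and hence alternating.
    The mutual influence of \<open>i\<close> and \<open>j\<close> drops out, and the two terms from
    \<open>k\<close> carry opposite signs.\<close>
  have cross: "hinner (hcross (X$j) (X$i)) (X$j) = 0" "hinner (X$i) (hcross (X$i) (X$j)) = 0"
      "hinner (X$i) (hcross (X$k) (X$j)) = - ?D"
    by (simp_all add: hinner_def hcross_def algebra_simps)
  interpret bounded_bilinear hinner
    by (rule bounded_bilinear_hinner)
  have "(1/pi) * (?w i k * ?D - ?w j k * ?D) = 0"
    using stat unfolding F scaleR_left scaleR_right add_left add_right cross
    by (simp add: algebra_simps)
  then have "?w i k = ?w j k"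
    using D by simp
  \<comment> \<open>As \<open>inverse 0 = 0\<close>, inversion is injective on all reals, so the
    denominators can be compared without a case split.\<close>
  then have "(hinner (X$i) (X$k))\<^sup>2 - 1 = (hinner (X$j) (X$k))\<^sup>2 - 1"
    using \<Gamma> by (metis divide_inverse inverse_eq_iff_eq mult_cancel_left)
  then have "\<bar>hinner (X$i) (X$k)\<bar> = \<bar>hinner (X$j) (X$k)\<bar>"
    by (simp add: power2_eq_iff abs_eq_iff)
  \<comment> \<open>Both products are at most -1, so equal absolute values mean equal
    values.\<close>
  then show ?thesis
    using hinner_le_minus_one[OF hyp hyp, of i k] hinner_le_minus_one[OF hyp hyp, of j k] by linarith
qed

lemma geodesic_configuration_if_det_0:
  fixes X :: "real^3^3"
  assumes "det X = 0" "\<And>r. X$r \<in> hyp_plane"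
  shows "geodesic_configuration X"
proof -
  \<comment> \<open>The rows of \<open>X\<close> are the three points, so a kernel vector is a
    Euclidean normal to a plane through the origin containing them all.\<close>
  obtain n where n: "n \<noteq> 0" "X *v n = 0"
    using assms(1) invertible_det_nz invertible_left_inverse matrix_left_invertible_ker by metis
  let ?P = "{x. n \<bullet> x = 0}"
  have mem: "X$r \<in> ?P" for r
    using n(2) by (metis (mono_tags) inner_commute matrix_vector_mul_component mem_Collect_eq zero_index)
  have "dim ?P = 2" "subspace ?P"
    using n(1) by (simp_all add: dim_hyperplane subspace_hyperplane)
  then have "hyp_plane \<inter> ?P \<in> geodesics"
    using mem assms(2) unfolding geodesics_def by blast
  then show ?thesis
    unfolding geodesic_configuration_def using mem assms(2) by blast
qed

theorem theorem2:
  fixes \<Gamma> :: "real^3" and X :: "real^3^3"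
  assumes "\<forall>r. \<Gamma>$r \<noteq> 0"
    and "relative_equilibrium \<Gamma> X"
  shows "equilateral X \<or> geodesic_configuration X"
proof (cases "det X = 0")
  case True
  then show ?thesis
    using assms(2) geodesic_configuration_if_det_0
    by (auto simp: relative_equilibrium_def phase_space_def)
next
  case False
  have hyp: "X$r \<in> hyp_plane" for r
    using assms(2) by (simp add: relative_equilibrium_def phase_space_def)
  note side = hinner_eq_if_stationary[OF _ _ _ _ _ _ hyp
      relative_equilibrium_hinner_stationary[OF assms(2)]]
  have D: "hinner (hcross (X$3) (X$1)) (X$2) \<noteq> 0" "hinner (hcross (X$1) (X$2)) (X$3) \<noteq> 0"
    using False by (simp_all add: det_3 hinner_def hcross_def algebra_simps)
  have univ: "(UNIV :: 3 set) = {1, 2, 3}" "(UNIV :: 3 set) = {2, 3, 1}"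
    by (auto simp: UNIV_3)
  \<comment> \<open>Vortex 3 acting on the side 12 equates the sides 13 and 23; vortex 1 acting on
    the side 23 then equates 12 and 13.\<close>
  have "hinner (X$1) (X$3) = hinner (X$2) (X$3)"
    by (rule side[OF _ D(1) univ(1)]) (simp_all add: assms(1))
  moreover have "hinner (X$2) (X$1) = hinner (X$3) (X$1)"
    by (rule side[OF _ D(2) univ(2)]) (simp_all add: assms(1))
  ultimately have "hinner (X$1) (X$2) = hinner (X$2) (X$3)" "hinner (X$2) (X$3) = hinner (X$3) (X$1)"
    by (metis hinner_commute)+
  then show ?thesis
    by (simp add: equilateral_def hdist_def)
qed

end
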